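(* Let $n\ge 2$. The correspondences $\mathbf A\mapsto\mathbf A^*$ and $\mathbf B\mapsto\mathbf B^\bullet$ define a term equivalence between the variety of $n\mathrm{BA}$s and the variety of skew star algebras. More precisely: (i) if $\mathbf A$ is an $n\mathrm{BA}$, then $\mathbf A^*$ is a skew star algebra; (ii) if $\mathbf B$ is a skew star algebra, then $\mathbf B^\bullet$ is an $n\mathrm{BA}$; (iii) $(\mathbf A^* )^\bullet=\mathbf A$ for every $n\mathrm{BA}$ $\mathbf A$; (iv) $(\mathbf B^\bullet)^*=\mathbf B$ for every skew star algebra $\mathbf B$.
   Context: Let $n\ge 2$. An $n\mathrm{BA}$ (Boolean-like algebra of dimension $n$) is an algebra $\mathbf A=(A,q,\mathsf e_1,\dots,\mathsf e_n)$ with $q$ of arity $n+1$ and constants $\mathsf e_1,\dots,\mathsf e_n$ satisfying the identities (B0) $q(\mathsf e_i,x^1,\dots,x^n)=x^i$ for $i=1,\dots,n$; (B1) $q(y,x,\dots,x)=x$; (B2) $q(y,q(y,x^{11},\dots,x^{1n}),\dots,q(y,x^{n1},\dots,x^{nn}))=q(y,x^{11},x^{22},\dots,x^{nn})$; (B3) $q(y,q(x^{10},\dots,x^{1n}),\dots,q(x^{n0},\dots,x^{nn}))=q(q(y,x^{10},\dots,x^{n0}),\dots,q(y,x^{1n},\dots,x^{nn}))$; (B4) $q(y,\mathsf e_1,\dots,\mathsf e_n)=y$. A semicentral right Church algebra (SRCA) is an algebra $(A,t,0)$ of type $(3,0)$ such that $t(0,x,y)=y$ for all $x,y$, and such that for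 every $x\in A$: $t(x,x,0)=x$, and $f_x(a,b)=t(x,a,b)$ is a binary decomposition operator on $(A,t,0)$, i.e. $f_x(a,a)=a$; $f_x(f_x(a,b),f_x(c,d))=f_x(a,d)$; and $f_x$ is a homomorphism $(A,t,0)^2\to(A,t,0)$. A skew star algebra is an algebra $\mathbf B=(B,t_i,0_i)_{1\le i\le n}$, each $t_i$ ternary and each $0_i$ a constant, such that for all $i\ne j$ in $\{1,\dots,n\}$: (N0) $(B,t_i,0_i)$ is an SRCA for every $1\le i\le n$; (N1) $t_i(0_j,y,z)=y$; (N2) $t_1(x,t_2(x,t_3(x,(\dots t_{n-1}(x,0_n,0_{n-1})\dots),0_3),0_2),0_1)=x$; (N3) $t_i(x,t_j(x,y,z),u)=t_j(x,t_i(x,y,u),z)$; (N4) for every $1\le i\le n$, $t_i(x,y,z)=t_1(x,t_2(x,t_3(x,\dots t_{n-1}(x,w_n,w_{n-1})\dots,w_3),w_2),w_1)$, where $w_i=z$ and $w_k=y$ for all $k\ne i$; (N5) $t_i(x,t_j(y^1,y^2,y^3),t_j(z^1,z^2,z^3))=t_j(t_i(x,y^1,z^1),t_i(x,y^2,z^2),t_i(x,y^3,z^3))$. Correspondences. For an $n\mathrm{BA}$ $\mathbf A$, $\mathbf A^*=(A,t_i,0_i)_{1\le i\le n}$ where $0_i:=\mathsf e_i$ and $t_i(x,y,z):=q(x,w_1,\dots,w_n)$ with $w_i=z$ and $w_k=y$ for $k\neq i$. For a skew star algebra $\mathbf B$, $\mathbf B^\bullet=(B,q_t,\mathsf e_1,\dots,\mathsf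 e_n)$ where $\mathsf e_i:=0_i$ and $$q_t(x,y_1,\dots,y_n):=t_1(x,t_2(x,t_3(x,\dots t_{n-1}(x,y_n,y_{n-1})\dots,y_3),y_2),y_1).$$ *)

theory Defs
  imports "HOL-Algebra.Congruence"
begin

text \<open>
  An \<open>n\<close>-tuple over \<open>A\<close> is an element of \<open>{1..n} \<rightarrow>\<^sub>E A\<close>. All operations are kept extensional
  (value \<open>undefined\<close> off the carrier), so that equality of records is exactly equality of algebras.
\<close>

record 'a q_algebra = "'a partial_object" +
  qop :: "'a \<Rightarrow> (nat \<Rightarrow> 'a) \<Rightarrow> 'a"
  econst :: "nat \<Rightarrow> 'a"

record 'a t_algebra = "'a partial_object" +
  tops :: "nat \<Rightarrow> 'a \<Rightarrow> 'a \<Rightarrow> 'a \<Rightarrow> 'a"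
  zeros :: "nat \<Rightarrow> 'a"

definition is_q_algebra :: "nat \<Rightarrow> 'a q_algebra \<Rightarrow> bool" where
  "is_q_algebra n A \<longleftrightarrow>
     qop A \<in> carrier A \<rightarrow>\<^sub>E ({1..n} \<rightarrow>\<^sub>E carrier A) \<rightarrow>\<^sub>E carrier A \<and>
     econst A \<in> {1..n} \<rightarrow>\<^sub>E carrier A"

definition is_t_algebra :: "nat \<Rightarrow> 'a t_algebra \<Rightarrow> bool" where
  "is_t_algebra n B \<longleftrightarrow>
     tops B \<in> {1..n} \<rightarrow>\<^sub>E carrier B \<rightarrow>\<^sub>E carrier B \<rightarrow>\<^sub>E carrier B \<rightarrow>\<^sub>E carrier B \<and>
     zeros B \<in> {1..n} \<rightarrow>\<^sub>E carrier B"

text \<open>In the fourth identity below, the entry \<open>x k 0\<close> is the first argument of the \<open>k\<close>-th inner \<open>q\<close>.\<close>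

definition nBA :: "nat \<Rightarrow> 'a q_algebra \<Rightarrow> bool" where
  "nBA n A \<longleftrightarrow> is_q_algebra n A \<and>
     (let C = carrier A; q = qop A; e = econst A in
       (\<forall>i\<in>{1..n}. \<forall>x\<in>{1..n} \<rightarrow>\<^sub>E C. q (e i) x = x i) \<and>
       (\<forall>y\<in>C. \<forall>x\<in>C. q y (\<lambda>k\<in>{1..n}. x) = x) \<and>
       (\<forall>y\<in>C. \<forall>x\<in>{1..n} \<rightarrow> ({1..n} \<rightarrow>\<^sub>E C).
          q y (\<lambda>k\<in>{1..n}. q y (x k)) = q y (\<lambda>k\<in>{1..n}. x k k)) \<and>
       (\<forall>y\<in>C. \<forall>x\<in>{1..n} \<rightarrow> ({0..n} \<rightarrow> C).
          q y (\<lambda>k\<in>{1..n}. q (x k 0) (\<lambda>l\<in>{1..n}. x k l)) =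
          q (q y (\<lambda>k\<in>{1..n}. x k 0)) (\<lambda>l\<in>{1..n}. q y (\<lambda>k\<in>{1..n}. x k l))) \<and>
       (\<forall>y\<in>C. q y e = y))"

text \<open>The last two conjuncts say that \<open>f\<close> is a homomorphism \<open>(A,t,0)\<^sup>2 \<rightarrow> (A,t,0)\<close>.\<close>

definition binary_decomposition_operator ::
    "'a set \<Rightarrow> ('a \<Rightarrow> 'a \<Rightarrow> 'a \<Rightarrow> 'a) \<Rightarrow> 'a \<Rightarrow> ('a \<Rightarrow> 'a \<Rightarrow> 'a) \<Rightarrow> bool" where
  "binary_decomposition_operator A t z f \<longleftrightarrow>
     f \<in> A \<rightarrow> A \<rightarrow> A \<and>
     (\<forall>a\<in>A. f a a = a) \<and>
     (\<forall>a\<in>A. \<forall>b\<in>A. \<forall>c\<in>A. \<forall>d\<in>A. f (f a b) (f c d) = f a d) \<and>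
     (\<forall>a1\<in>A. \<forall>a2\<in>A. \<forall>a3\<in>A. \<forall>b1\<in>A. \<forall>b2\<in>A. \<forall>b3\<in>A.
        f (t a1 a2 a3) (t b1 b2 b3) = t (f a1 b1) (f a2 b2) (f a3 b3)) \<and>
     f z z = z"

definition srca :: "'a set \<Rightarrow> ('a \<Rightarrow> 'a \<Rightarrow> 'a \<Rightarrow> 'a) \<Rightarrow> 'a \<Rightarrow> bool" where
  "srca A t z \<longleftrightarrow>
     t \<in> A \<rightarrow> A \<rightarrow> A \<rightarrow> A \<and> z \<in> A \<and>
     (\<forall>x\<in>A. \<forall>y\<in>A. t z x y = y) \<and>
     (\<forall>x\<in>A. t x x z = x \<and> binary_decomposition_operator A t z (t x))"

text \<open>\<open>t\<^sub>1(x, t\<^sub>2(x, \<dots> t\<^sub>n\<^sub>-\<^sub>1(x, y\<^sub>n, y\<^sub>n\<^sub>-\<^sub>1) \<dots>, y\<^sub>2), y\<^sub>1)\<close>, for \<open>n \<ge> 2\<close>\<close>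

definition nested :: "nat \<Rightarrow> (nat \<Rightarrow> 'a \<Rightarrow> 'a \<Rightarrow> 'a \<Rightarrow> 'a) \<Rightarrow> 'a \<Rightarrow> (nat \<Rightarrow> 'a) \<Rightarrow> 'a" where
  "nested n t x y = foldr (\<lambda>k u. t k x u (y k)) [1..<n] (y n)"

definition skew_star_algebra :: "nat \<Rightarrow> 'a t_algebra \<Rightarrow> bool" where
  "skew_star_algebra n B \<longleftrightarrow> is_t_algebra n B \<and>
     (let C = carrier B; t = tops B; z = zeros B in
       (\<forall>i\<in>{1..n}. srca C (t i) (z i)) \<and>
       (\<forall>i\<in>{1..n}. \<forall>j\<in>{1..n}. i \<noteq> j \<longrightarrow> (\<forall>a\<in>C. \<forall>b\<in>C. t i (z j) a b = a)) \<and>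
       (\<forall>x\<in>C. nested n t x z = x) \<and>
       (\<forall>i\<in>{1..n}. \<forall>j\<in>{1..n}. i \<noteq> j \<longrightarrow>
          (\<forall>x\<in>C. \<forall>a\<in>C. \<forall>b\<in>C. \<forall>u\<in>C. t i x (t j x a b) u = t j x (t i x a u) b)) \<and>
       (\<forall>i\<in>{1..n}. \<forall>x\<in>C. \<forall>a\<in>C. \<forall>b\<in>C.
          t i x a b = nested n t x (\<lambda>k. if k = i then b else a)) \<and>
       (\<forall>i\<in>{1..n}. \<forall>j\<in>{1..n}. i \<noteq> j \<longrightarrow>
          (\<forall>x\<in>C. \<forall>a1\<in>C. \<forall>a2\<in>C. \<forall>a3\<in>C. \<forall>b1\<in>C. \<forall>b2\<in>C. \<forall>b3\<in>C.
             t i x (t j a1 a2 a3) (t j b1 b2 b3) =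
             t j (t i x a1 b1) (t i x a2 b2) (t i x a3 b3))))"

definition star :: "nat \<Rightarrow> 'a q_algebra \<Rightarrow> 'a t_algebra" where
  "star n A =
     \<lparr>carrier = carrier A,
      tops = (\<lambda>i\<in>{1..n}. \<lambda>x\<in>carrier A. \<lambda>y\<in>carrier A. \<lambda>z\<in>carrier A.
                qop A x (\<lambda>k\<in>{1..n}. if k = i then z else y)),
      zeros = econst A\<rparr>"

definition bullet :: "nat \<Rightarrow> 'a t_algebra \<Rightarrow> 'a q_algebra" where
  "bullet n B =
     \<lparr>carrier = carrier B,
      qop = (\<lambda>x\<in>carrier B. \<lambda>y\<in>{1..n} \<rightarrow>\<^sub>E carrier B. nested n (tops B) x y),
      econst = zeros B\<rparr>"

end

theory Submission
  imports Defs
begin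

text \<open>
  For fixed \<open>x\<close>, the operation \<open>q(x,-)\<close> of an \<open>n\<close>BA is an \<open>n\<close>-ary decomposition operator, so
  nested occurrences of \<open>q(x,-)\<close> collapse coordinatewise; unfolding the nested term from the inside
  shows that it computes \<open>q\<close>. Conversely, in a skew star algebra the maps \<open>u \<mapsto> t\<^sub>k(x,u,c)\<close> commute
  for distinct \<open>k\<close> (N3), the outer one absorbs the inner one for equal \<open>k\<close>, and
  \<open>t\<^sub>i(x,u,t\<^sub>k(x,v,w)) = t\<^sub>i(x,u,v)\<close> for \<open>i \<noteq> k\<close>. These laws give (B2), whereas (B3) holds because
  every \<open>t\<^sub>k(x,-,-)\<close> is a homomorphism for all the \<open>t\<^sub>j\<close>.
\<close>

section \<open>Folds of ternary layers\<close>

lemma foldr_closed: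
  assumes "\<And>k u. k \<in> set ks \<Longrightarrow> u \<in> C \<Longrightarrow> f k u \<in> C" "u \<in> C"
  shows "foldr f ks u \<in> C"
  using assms by (induction ks) auto

lemma nested_cong:
  assumes "\<And>k u. 1 \<le> k \<Longrightarrow> k < n \<Longrightarrow> t k x u (y k) = t' k x u (y' k)"
    and "y n = y' n"
  shows "nested n t x y = nested n t' x y'"
  unfolding nested_def using assms by (intro foldr_cong) auto

section \<open>Ternary operations derived from an nBA\<close>

locale boolean_like_algebra =
  fixes n :: nat and A :: "'a q_algebra"
  assumes nBA: "nBA n A" and n_ge_2: "n \<ge> 2"
begin

abbreviation "C \<equiv> carrier A"
abbreviation "q \<equiv> qop A"
abbreviation "e \<equiv> econst A"
abbreviation "I \<equiv> {1..n}"

text \<open>The operation of \<open>star n A\<close> without its restrictions to indices and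
  carrier, so that it unfolds unconditionally; \<open>tops_star\<close> relates the two.\<close>

definition t :: "nat \<Rightarrow> 'a \<Rightarrow> 'a \<Rightarrow> 'a \<Rightarrow> 'a" where
  "t i x a b = q x (\<lambda>k\<in>I. if k = i then b else a)"

lemma q_mem: "q \<in> C \<rightarrow>\<^sub>E (I \<rightarrow>\<^sub>E C) \<rightarrow>\<^sub>E C"
  and e_mem: "e \<in> I \<rightarrow>\<^sub>E C"
  using nBA by (auto simp: nBA_def is_q_algebra_def)

lemma q_closed [simp]: "x \<in> C \<Longrightarrow> y \<in> I \<rightarrow>\<^sub>E C \<Longrightarrow> q x y \<in> C"
  by (rule PiE_mem[OF PiE_mem[OF q_mem]])

lemma e_closed [simp]: "i \<in> I \<Longrightarrow> e i \<in> C"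
  using e_mem by (rule PiE_mem)

lemma q_e: "i \<in> I \<Longrightarrow> x \<in> I \<rightarrow>\<^sub>E C \<Longrightarrow> q (e i) x = x i"
  and q_const: "y \<in> C \<Longrightarrow> a \<in> C \<Longrightarrow> q y (\<lambda>k\<in>I. a) = a"
  and q_diag: "y \<in> C \<Longrightarrow> X \<in> I \<rightarrow> (I \<rightarrow>\<^sub>E C) \<Longrightarrow> q y (\<lambda>k\<in>I. q y (X k)) = q y (\<lambda>k\<in>I. X k k)"
  and q_unit: "y \<in> C \<Longrightarrow> q y e = y"
  using nBA unfolding nBA_def Let_def by blast+

text \<open>This is (B3) with column 0 split off as \<open>X0\<close>, so that the heads and the
  entries of the inner \<open>q\<close> can be chosen separately.\<close>

lemma q_hom:
  assumes "y \<in> C" "X0 \<in> I \<rightarrow> C" "X \<in> I \<rightarrow> I \<rightarrow> C"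
  shows "q y (\<lambda>k\<in>I. q (X0 k) (\<lambda>l\<in>I. X k l)) =
         q (q y (\<lambda>k\<in>I. X0 k)) (\<lambda>l\<in>I. q y (\<lambda>k\<in>I. X k l))"
proof -
  let ?Z = "\<lambda>k l. if l = 0 then X0 k else X k l"
  have Z: "?Z \<in> I \<rightarrow> {0..n} \<rightarrow> C"
    using assms(2,3) by (auto simp: Pi_def)
  have r: "(\<lambda>l\<in>I. ?Z k l) = (\<lambda>l\<in>I. X k l)" for k
    by (rule restrict_ext) simp
  have r': "(\<lambda>l\<in>I. q y (\<lambda>k\<in>I. ?Z k l)) = (\<lambda>l\<in>I. q y (\<lambda>k\<in>I. X k l))"
    by (rule restrict_ext) simp
  have "\<forall>y\<in>C. \<forall>x\<in>I \<rightarrow> ({0..n} \<rightarrow> C).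
      q y (\<lambda>k\<in>I. q (x k 0) (\<lambda>l\<in>I. x k l)) =
      q (q y (\<lambda>k\<in>I. x k 0)) (\<lambda>l\<in>I. q y (\<lambda>k\<in>I. x k l))"
    using nBA unfolding nBA_def Let_def by blast
  from bspec[OF bspec[OF this assms(1)] Z] show ?thesis
    unfolding r r' by simp
qed

lemma t_closed [simp]: "x \<in> C \<Longrightarrow> a \<in> C \<Longrightarrow> b \<in> C \<Longrightarrow> t i x a b \<in> C"
  unfolding t_def by (intro q_closed) auto

text \<open>A form of (B2) for entries that are only equal to values of \<open>q y\<close>. Thus an
  entry \<open>c\<close> can be read as \<open>q y\<close> of a constant tuple by (B1), and the
  entry \<open>y\<close> as \<open>q y e\<close> by (B4).\<close>

lemma q_collapse:
  assumes "y \<in> C" "X \<in> I \<rightarrow> (I \<rightarrow>\<^sub>E C)" "\<And>k. k \<in> I \<Longrightarrow> z k = q y (X k)"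
  shows "q y (\<lambda>k\<in>I. z k) = q y (\<lambda>k\<in>I. X k k)"
proof -
  have "(\<lambda>k\<in>I. z k) = (\<lambda>k\<in>I. q y (X k))"
    using assms(3) by (rule restrict_ext)
  then show ?thesis using q_diag[OF assms(1,2)] by simp
qed

lemma t_same: "x \<in> C \<Longrightarrow> a \<in> C \<Longrightarrow> t i x a a = a"
  using q_const by (simp add: t_def)

text \<open>Downward induction on \<open>m\<close>, adding layers from the inside out. The seed
  \<open>y n\<close> is \<open>q x\<close> of a constant tuple, and layer \<open>m\<close>
  overwrites exactly coordinate \<open>m\<close>.\<close>

lemma foldr_t:
  assumes "x \<in> C" "y \<in> I \<rightarrow> C" "1 \<le> m" "m \<le> n"
  shows "foldr (\<lambda>k u. t k x u (y k)) [m..<n] (y n) = q x (\<lambda>l\<in>I. if m \<le> l then y l else y n)"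
proof -
  have y: "k \<in> I \<Longrightarrow> y k \<in> C" for k
    using assms(2) by (rule Pi_mem)
  show ?thesis
    using \<open>m \<le> n\<close> \<open>1 \<le> m\<close>
  proof (induction m rule: inc_induct)
    case base
    have "(\<lambda>l\<in>I. if n \<le> l then y l else y n) = (\<lambda>l\<in>I. y n)"
      by (rule restrict_ext) auto
    moreover have "y n \<in> C" using y n_ge_2 by simp
    ultimately have "q x (\<lambda>l\<in>I. if n \<le> l then y l else y n) = y n"
      using q_const[of x "y n"] assms(1) by (simp only:)
    then show "foldr (\<lambda>k u. t k x u (y k)) [n..<n] (y n) = q x (\<lambda>l\<in>I. if n \<le> l then y l else y n)"
      by simp
  next
    case (step m)
    let ?w = "\<lambda>l\<in>I. if Suc m \<le> l then y l else y n"
    have w: "?w \<in> I \<rightarrow>\<^sub>E C" using y n_ge_2 by auto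
    have ym: "y m \<in> C" using y step by simp
    \<comment> \<open>Row \<open>m\<close> is constant because \<open>y m\<close> has to be written
      as a value of \<open>q x\<close>; the diagonal of \<open>?X\<close> is \<open>?w\<close> with
      coordinate \<open>m\<close> replaced by \<open>y m\<close>.\<close>
    let ?X = "\<lambda>k. if k = m then (\<lambda>l\<in>I. y m) else ?w"
    have IH: "foldr (\<lambda>k u. t k x u (y k)) [Suc m..<n] (y n) = q x ?w"
      by (rule step.IH) simp
    have "foldr (\<lambda>k u. t k x u (y k)) [m..<n] (y n) = t m x (q x ?w) (y m)"
      using IH step.hyps by (simp add: upt_conv_Cons)
    also have "\<dots> = q x (\<lambda>k\<in>I. ?X k k)"
      unfolding t_def
      by (rule q_collapse[where X = ?X]) (use assms w ym q_const[of x "y m"] in auto)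
    also have "\<dots> = q x (\<lambda>l\<in>I. if m \<le> l then y l else y n)"
      by (rule arg_cong[where f = "q x"], rule restrict_ext) auto
    finally show ?case .
  qed
qed

lemma nested_t:
  assumes "x \<in> C" "y \<in> I \<rightarrow> C"
  shows "nested n t x y = q x (\<lambda>k\<in>I. y k)"
proof -
  have "(\<lambda>l\<in>I. if 1 \<le> l then y l else y n) = (\<lambda>k\<in>I. y k)"
    by (rule restrict_ext) auto
  then show ?thesis
    using foldr_t[OF assms, of 1] n_ge_2 unfolding nested_def by simp
qed

text \<open>An instance of (B3) whose row \<open>i\<close> is built from the \<open>b\<close>s and
  whose other rows are built from the \<open>a\<close>s. The case \<open>i = j\<close> is included,
  so it serves both (N0) and (N5).\<close>

lemma t_hom:
  assumes "x \<in> C" "a1 \<in> C" "a2 \<in> C" "a3 \<in> C" "b1 \<in> C" "b2 \<in> C" "b3 \<in> C"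
  shows "t i x (t j a1 a2 a3) (t j b1 b2 b3) = t j (t i x a1 b1) (t i x a2 b2) (t i x a3 b3)"
proof -
  let ?P = "\<lambda>k. if k = i then b1 else a1"
  let ?X = "\<lambda>k l. if k = i then (if l = j then b3 else b2) else (if l = j then a3 else a2)"
  have "(\<lambda>k\<in>I. if k = i then t j b1 b2 b3 else t j a1 a2 a3) =
        (\<lambda>k\<in>I. q (?P k) (\<lambda>l\<in>I. ?X k l))"
    by (rule restrict_ext) (simp add: t_def)
  moreover have "q x (\<lambda>k\<in>I. q (?P k) (\<lambda>l\<in>I. ?X k l)) =
      q (q x (\<lambda>k\<in>I. ?P k)) (\<lambda>l\<in>I. q x (\<lambda>k\<in>I. ?X k l))"
    by (rule q_hom) (use assms in auto)
  moreover have "(\<lambda>l\<in>I. q x (\<lambda>k\<in>I. ?X k l)) =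
      (\<lambda>l\<in>I. if l = j then t i x a3 b3 else t i x a2 b2)"
    by (rule restrict_ext) (simp add: t_def)
  ultimately show ?thesis
    unfolding t_def[of i x "t j a1 a2 a3"] t_def[of j "t i x a1 b1"]
    unfolding t_def[of i x a1 b1] by simp
qed

lemma t_diag:
  assumes "x \<in> C" "a \<in> C" "b \<in> C" "c \<in> C" "d \<in> C"
  shows "t i x (t i x a b) (t i x c d) = t i x a d"
proof -
  let ?X = "\<lambda>k. if k = i then (\<lambda>l\<in>I. if l = i then d else c) else (\<lambda>l\<in>I. if l = i then b else a)"
  have "t i x (t i x a b) (t i x c d) = q x (\<lambda>k\<in>I. ?X k k)"
    unfolding t_def by (rule q_collapse[where X = ?X]) (use assms in auto)
  also have "\<dots> = q x (\<lambda>k\<in>I. if k = i then d else a)"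
    by (rule arg_cong[where f = "q x"], rule restrict_ext) auto
  finally show ?thesis by (simp add: t_def)
qed

text \<open>Reading \<open>u\<close> as \<open>q x\<close> of a constant tuple, (B2) gives the
  coordinates of the composite explicitly. Both sides of (N3) can then be compared as
  tuples.\<close>

lemma t_nested_other:
  assumes "x \<in> C" "a \<in> C" "b \<in> C" "u \<in> C" "i \<noteq> j"
  shows "t i x (t j x a b) u = q x (\<lambda>k\<in>I. if k = i then u else if k = j then b else a)"
proof -
  let ?X = "\<lambda>k. if k = i then (\<lambda>l\<in>I. u) else (\<lambda>l\<in>I. if l = j then b else a)"
  have "t i x (t j x a b) u = q x (\<lambda>k\<in>I. ?X k k)"
    unfolding t_def[of i] by (rule q_collapse[where X = ?X]) (use assms q_const[of x u] in \<open>auto simp: t_def\<close>)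
  also have "\<dots> = q x (\<lambda>k\<in>I. if k = i then u else if k = j then b else a)"
    by (rule arg_cong[where f = "q x"], rule restrict_ext) auto
  finally show ?thesis .
qed

lemma t_commute:
  assumes "x \<in> C" "a \<in> C" "b \<in> C" "u \<in> C" "i \<noteq> j"
  shows "t i x (t j x a b) u = t j x (t i x a u) b"
proof -
  have "(\<lambda>k\<in>I. if k = i then u else if k = j then b else a) =
        (\<lambda>k\<in>I. if k = j then b else if k = i then u else a)"
    using assms(5) by (intro restrict_ext) auto
  then show ?thesis using assms t_nested_other[of x a b u i j] t_nested_other[of x a u b j i]
    by simp
qed

lemma t_e: "i \<in> I \<Longrightarrow> j \<in> I \<Longrightarrow> a \<in> C \<Longrightarrow> b \<in> C \<Longrightarrow> t i (e j) a b = (if j = i then b else a)"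
  unfolding t_def by (subst q_e) auto

text \<open>By (B4), \<open>x\<close> is \<open>q x e\<close>, and by (B1), \<open>e i\<close> is
  \<open>q x\<close> of a constant tuple. The diagonal of these rows is again
  \<open>e\<close>.\<close>

lemma t_unit:
  assumes "x \<in> C" "i \<in> I"
  shows "t i x x (e i) = x"
proof -
  let ?X = "\<lambda>k. if k = i then (\<lambda>l\<in>I. e i) else e"
  have "t i x x (e i) = q x (\<lambda>k\<in>I. ?X k k)"
    unfolding t_def
    by (rule q_collapse[where X = ?X]) (use assms e_mem q_const[of x "e i"] q_unit[of x] in auto)
  also have "\<dots> = q x (restrict e I)"
    by (rule arg_cong[where f = "q x"], rule restrict_ext) auto
  also have "\<dots> = x" using q_unit assms by (simp only: PiE_restrict[OF e_mem])
  finally show ?thesis .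
qed

section \<open>The skew star algebra of an nBA, and the way back\<close>

lemma tops_star: "i \<in> I \<Longrightarrow> x \<in> C \<Longrightarrow> a \<in> C \<Longrightarrow> b \<in> C \<Longrightarrow> tops (star n A) i x a b = t i x a b"
  by (simp add: star_def t_def)

text \<open>The operations of \<open>star n A\<close> are identified with \<open>t\<close> on the
  carrier only, so the induction also tracks that every intermediate value of the fold stays in
  \<open>C\<close>.\<close>

lemma nested_star:
  assumes x: "x \<in> C" and y: "y \<in> I \<rightarrow> C"
  shows "nested n (tops (star n A)) x y = q x (\<lambda>k\<in>I. y k)"
proof -
  have "foldr (\<lambda>k u. tops (star n A) k x u (y k)) ks (y n) = foldr (\<lambda>k u. t k x u (y k)) ks (y n)"
    if "set ks \<subseteq> I" for ks
    using that
  proof (induction ks)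
    case (Cons k ks)
    have "foldr (\<lambda>k u. t k x u (y k)) ks (y n) \<in> C"
      using Cons.prems x y n_ge_2 by (intro foldr_closed) (auto simp: Pi_def subset_iff)
    then show ?case using Cons x y by (auto simp: tops_star Pi_def)
  qed simp
  from this[of "[1..<n]"] show ?thesis
    using nested_t[OF x y] by (simp add: nested_def subset_iff)
qed

lemma srca_star:
  assumes "i \<in> I"
  shows "srca C (tops (star n A) i) (e i)"
proof -
  have "binary_decomposition_operator C (tops (star n A) i) (e i) (tops (star n A) i x)"
    if "x \<in> C" for x
    unfolding binary_decomposition_operator_def
  proof (intro conjI)
    show "\<forall>a1\<in>C. \<forall>a2\<in>C. \<forall>a3\<in>C. \<forall>b1\<in>C. \<forall>b2\<in>C. \<forall>b3\<in>C.
      tops (star n A) i x (tops (star n A) i a1 a2 a3) (tops (star n A) i b1 b2 b3) =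
      tops (star n A) i (tops (star n A) i x a1 b1) (tops (star n A) i x a2 b2)
        (tops (star n A) i x a3 b3)"
      using assms that by (intro ballI) (simp only: tops_star t_closed, rule t_hom)
  qed (use assms that in \<open>simp_all add: tops_star t_same t_diag del: atLeastAtMost_iff\<close>)
  then show ?thesis
    unfolding srca_def using assms by (simp add: tops_star t_e t_unit del: atLeastAtMost_iff)
qed

lemma skew_star_algebra_star: "skew_star_algebra n (star n A)"
proof -
  let ?s = "tops (star n A)"
  have carrier [simp]: "carrier (star n A) = C" and zeros [simp]: "zeros (star n A) = e"
    by (simp_all add: star_def)
  have "is_t_algebra n (star n A)"
    unfolding is_t_algebra_def star_def using e_mem by (auto intro!: q_closed)
  moreover have "\<forall>i\<in>I. srca C (?s i) (e i)"
    using srca_star by blast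
  moreover have "\<forall>i\<in>I. \<forall>j\<in>I. i \<noteq> j \<longrightarrow> (\<forall>a\<in>C. \<forall>b\<in>C. ?s i (e j) a b = a)"
    by (simp add: tops_star t_e del: atLeastAtMost_iff)
  moreover have "\<forall>x\<in>C. nested n ?s x e = x"
  proof
    fix x assume x: "x \<in> C"
    have "restrict e I = e" using e_mem by (rule PiE_restrict)
    then show "nested n ?s x e = x"
      using nested_star[OF x, of e] q_unit[OF x] by simp
  qed
  moreover have "\<forall>i\<in>I. \<forall>j\<in>I. i \<noteq> j \<longrightarrow>
      (\<forall>x\<in>C. \<forall>a\<in>C. \<forall>b\<in>C. \<forall>u\<in>C. ?s i x (?s j x a b) u = ?s j x (?s i x a u) b)"
    by (intro ballI impI) (simp only: tops_star t_closed, rule t_commute)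
  moreover have "\<forall>i\<in>I. \<forall>x\<in>C. \<forall>a\<in>C. \<forall>b\<in>C.
      ?s i x a b = nested n ?s x (\<lambda>k. if k = i then b else a)"
    by (simp add: tops_star nested_star t_def del: atLeastAtMost_iff)
  moreover have "\<forall>i\<in>I. \<forall>j\<in>I. i \<noteq> j \<longrightarrow>
      (\<forall>x\<in>C. \<forall>a1\<in>C. \<forall>a2\<in>C. \<forall>a3\<in>C. \<forall>b1\<in>C. \<forall>b2\<in>C. \<forall>b3\<in>C.
         ?s i x (?s j a1 a2 a3) (?s j b1 b2 b3) =
         ?s j (?s i x a1 b1) (?s i x a2 b2) (?s i x a3 b3))"
    by (intro ballI impI) (simp only: tops_star t_closed, rule t_hom)
  ultimately show ?thesis
    unfolding skew_star_algebra_def Let_def carrier zeros by (intro conjI)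
qed

text \<open>On the carrier this is \<open>nested_star\<close>. Off the carrier, or off the
  extensional tuples, both operations are \<open>undefined\<close>, which makes the records equal
  outright.\<close>

lemma bullet_star: "bullet n (star n A) = A"
proof -
  have "(\<lambda>x\<in>C. \<lambda>y\<in>I \<rightarrow>\<^sub>E C. nested n (tops (star n A)) x y) = q"
  proof
    fix x
    show "(\<lambda>x\<in>C. \<lambda>y\<in>I \<rightarrow>\<^sub>E C. nested n (tops (star n A)) x y) x = q x"
    proof (cases "x \<in> C")
      case True
      have "nested n (tops (star n A)) x y = q x y" if y: "y \<in> I \<rightarrow>\<^sub>E C" for y
        using nested_star[OF True] PiE_restrict[OF y] y by (metis PiE_mem Pi_I)
      moreover have "q x y = undefined" if "y \<notin> I \<rightarrow>\<^sub>E C" for y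
        using PiE_arb[OF PiE_mem[OF q_mem True] that] .
      ultimately show ?thesis
        using True by (simp add: restrict_def fun_eq_iff del: atLeastAtMost_iff PiE_iff)
    qed (use PiE_arb[OF q_mem] in simp)
  qed
  then show ?thesis
    by (simp add: bullet_def star_def)
qed

end

section \<open>Laws of a skew star algebra\<close>

locale skew_star =
  fixes n :: nat and B :: "'a t_algebra"
  assumes ssa: "skew_star_algebra n B" and n_ge_2: "n \<ge> 2"
begin

abbreviation "C \<equiv> carrier B"
abbreviation "t \<equiv> tops B"
abbreviation "z \<equiv> zeros B"
abbreviation "I \<equiv> {1..n}"
abbreviation "N \<equiv> nested n t"

lemma t_mem: "t \<in> I \<rightarrow>\<^sub>E C \<rightarrow>\<^sub>E C \<rightarrow>\<^sub>E C \<rightarrow>\<^sub>E C"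
  and z_mem: "z \<in> I \<rightarrow>\<^sub>E C"
  using ssa by (auto simp: skew_star_algebra_def is_t_algebra_def)

lemma t_closed [simp]: "i \<in> I \<Longrightarrow> x \<in> C \<Longrightarrow> a \<in> C \<Longrightarrow> b \<in> C \<Longrightarrow> t i x a b \<in> C"
  by (rule PiE_mem[OF PiE_mem[OF PiE_mem[OF PiE_mem[OF t_mem]]]])

lemma z_closed [simp]: "i \<in> I \<Longrightarrow> z i \<in> C"
  using z_mem by (rule PiE_mem)

lemmas laws = ssa[unfolded skew_star_algebra_def Let_def, THEN conjunct2]
lemmas N0 = laws[THEN conjunct1]
lemmas N1 = laws[THEN conjunct2, THEN conjunct1]
lemmas N2 = laws[THEN conjunct2, THEN conjunct2, THEN conjunct1]
lemmas N3 = laws[THEN conjunct2, THEN conjunct2, THEN conjunct2, THEN conjunct1]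
lemmas N4 = laws[THEN conjunct2, THEN conjunct2, THEN conjunct2, THEN conjunct2, THEN conjunct1]
lemmas N5 = laws[THEN conjunct2, THEN conjunct2, THEN conjunct2, THEN conjunct2, THEN conjunct2]

lemma t_zero: "i \<in> I \<Longrightarrow> a \<in> C \<Longrightarrow> b \<in> C \<Longrightarrow> t i (z i) a b = b"
  and t_bdo: "i \<in> I \<Longrightarrow> x \<in> C \<Longrightarrow> binary_decomposition_operator C (t i) (z i) (t i x)"
  using N0[THEN bspec, of i] by (simp_all add: srca_def)

lemmas bdo_laws = t_bdo[unfolded binary_decomposition_operator_def, THEN conjunct2]

lemma t_same: "i \<in> I \<Longrightarrow> x \<in> C \<Longrightarrow> a \<in> C \<Longrightarrow> t i x a a = a"
  using bdo_laws[THEN conjunct1] by blast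

lemma t_diag: "i \<in> I \<Longrightarrow> x \<in> C \<Longrightarrow> a \<in> C \<Longrightarrow> b \<in> C \<Longrightarrow> c \<in> C \<Longrightarrow> d \<in> C \<Longrightarrow>
    t i x (t i x a b) (t i x c d) = t i x a d"
  using bdo_laws[THEN conjunct2, THEN conjunct1] by blast

lemma t_zero_other: "i \<in> I \<Longrightarrow> j \<in> I \<Longrightarrow> i \<noteq> j \<Longrightarrow> a \<in> C \<Longrightarrow> b \<in> C \<Longrightarrow> t i (z j) a b = a"
  using N1 by blast

lemma N_unit: "x \<in> C \<Longrightarrow> N x z = x"
  using N2 by blast

lemma t_commute: "i \<in> I \<Longrightarrow> j \<in> I \<Longrightarrow> i \<noteq> j \<Longrightarrow> x \<in> C \<Longrightarrow> a \<in> C \<Longrightarrow> b \<in> C \<Longrightarrow> u \<in> C \<Longrightarrow>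
    t i x (t j x a b) u = t j x (t i x a u) b"
  using N3 by blast

lemma t_eq_N: "i \<in> I \<Longrightarrow> x \<in> C \<Longrightarrow> a \<in> C \<Longrightarrow> b \<in> C \<Longrightarrow>
    t i x a b = N x (\<lambda>k. if k = i then b else a)"
  using N4 by blast

text \<open>For \<open>i = j\<close> this is the homomorphism part of (N0), otherwise it is (N5).
  The uniform form can be iterated along a fold without comparing indices.\<close>

lemma t_hom:
  assumes "i \<in> I" "j \<in> I" "x \<in> C" "a1 \<in> C" "a2 \<in> C" "a3 \<in> C" "b1 \<in> C" "b2 \<in> C" "b3 \<in> C"
  shows "t i x (t j a1 a2 a3) (t j b1 b2 b3) = t j (t i x a1 b1) (t i x a2 b2) (t i x a3 b3)"
proof (cases "i = j")
  case True
  then show ?thesis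
    using bdo_laws[THEN conjunct2, THEN conjunct2, THEN conjunct1, of i x] assms by blast
next
  case False
  then show ?thesis
    using N5 assms by blast
qed

text \<open>Idempotence writes \<open>c\<close> as \<open>t i x c c\<close>; then the decomposition
  law applies.\<close>

lemma t_absorb_left:
  assumes "i \<in> I" "x \<in> C" "a \<in> C" "b \<in> C" "c \<in> C"
  shows "t i x (t i x a b) c = t i x a c"
  using t_diag[of i x a b c c] t_same[of i x c] assms by simp

lemma t_absorb_right:
  assumes "i \<in> I" "x \<in> C" "a \<in> C" "b \<in> C" "c \<in> C"
  shows "t i x a (t i x b c) = t i x a c"
  using t_diag[of i x a a b c] t_same[of i x a] assms by simp

text \<open>Intuitively \<open>t i x u v\<close> takes coordinate \<open>i\<close> from
  \<open>v\<close> and the rest from \<open>u\<close>, and \<open>t k x v w\<close> agrees with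
  \<open>v\<close> at \<open>i\<close>. No coordinates are available here, so (N3), (N5) and
  idempotence replace them.\<close>

lemma t_absorb_other:
  assumes ik: "i \<in> I" "k \<in> I" "i \<noteq> k" and C: "x \<in> C" "u \<in> C" "v \<in> C" "w \<in> C"
  shows "t i x u (t k x v w) = t i x u v"
proof -
  \<comment> \<open>The case \<open>v = u\<close> comes first: (N3) exhibits
    \<open>t k x u w\<close> as a value of \<open>t i x\<close> with second argument
    \<open>u\<close>, which \<open>t_absorb_right\<close> then extracts.\<close>
  have "t i x (t k x u w) u = t k x u w"
    using t_commute[of i k x u w u] t_same[of i x u] assms by simp
  then have "t i x u (t k x u w) = u"
    using t_absorb_right[of i x u "t k x u w" u] t_same[of i x u] assms by simp
  \<comment> \<open>The homomorphism law with \<open>x\<close> written as \<open>t k x x x\<close>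
    and \<open>u\<close> as \<open>t i x u u\<close> on the left, \<open>t k x u u\<close> on the
    right.\<close>
  moreover have "t k x u (t i x u w) = t i x u (t k x u w)"
    using t_hom[of k i x x u u x u w] t_same assms by simp
  ultimately have u: "t k x u (t i x u w) = u"
    by simp
  have "t i x u (t k x v w) = t k x (t i x u v) (t i x u w)"
    using t_hom[of i k x x u u x v w] t_same assms by simp
  \<comment> \<open>(N3) moves \<open>v\<close> to the outside, and the remaining inner term equals
    \<open>u\<close> by the special case.\<close>
  also have "\<dots> = t i x (t k x u (t i x u w)) v"
    using t_commute[of k i x u v "t i x u w"] assms by auto
  finally show ?thesis using u by simp
qed

section \<open>The nested term: evaluation at the zeros and the homomorphism law\<close>

lemma foldr_t_closed:
  assumes "set ks \<subseteq> I" "x \<in> C" "y \<in> I \<rightarrow> C" "u \<in> C"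
  shows "foldr (\<lambda>k u. t k x u (y k)) ks u \<in> C"
  using assms by (intro foldr_closed) (auto simp: Pi_def subset_iff)

lemma set_upt_subset: "set [1..<n] \<subseteq> I"
  by auto

lemma n_mem: "n \<in> I"
  using n_ge_2 by simp

lemma N_closed [simp]: "x \<in> C \<Longrightarrow> y \<in> I \<rightarrow> C \<Longrightarrow> N x y \<in> C"
  unfolding nested_def using foldr_t_closed[OF set_upt_subset] n_mem by (auto simp: Pi_def)

lemma foldr_same:
  assumes "set ks \<subseteq> I" "x \<in> C" "a \<in> C"
  shows "foldr (\<lambda>k u. t k x u a) ks a = a"
  using assms by (induction ks) (auto simp: t_same simp del: atLeastAtMost_iff)

text \<open>At \<open>z i\<close>, layer \<open>i\<close> returns its own entry and every other
  layer passes the inner value through.\<close>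

lemma foldr_zero:
  assumes "set ks \<subseteq> I" "i \<in> I" "y \<in> I \<rightarrow> C" "u \<in> C"
  shows "foldr (\<lambda>k u. t k (z i) u (y k)) ks u = (if i \<in> set ks then y i else u)"
  using assms(1)
proof (induction ks)
  case (Cons k ks)
  have "foldr (\<lambda>k u. t k (z i) u (y k)) ks u \<in> C" "k \<in> I" "y k \<in> C" "y i \<in> C"
    using foldr_t_closed[of ks "z i" y u] assms Cons.prems by auto
  then show ?case
    using Cons t_zero[of i] t_zero_other[of k i] assms by (cases "k = i") auto
qed simp

lemma N_zero:
  assumes "i \<in> I" "y \<in> I \<rightarrow> C"
  shows "N (z i) y = y i"
proof -
  have "y n \<in> C" using assms n_mem by auto
  then show ?thesis
    \<comment> \<open>The layers cover \<open>1\<close> to \<open>n - 1\<close>; for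
      \<open>i = n\<close> all of them are transparent and the seed \<open>y n\<close>
      survives.\<close>
    using foldr_zero[OF set_upt_subset assms] assms(1) by (auto simp: nested_def)
qed

text \<open>Since \<open>t j x\<close> is a homomorphism for every \<open>t k\<close>, it passes
  through one layer at a time and acts separately on heads, entries and seeds.\<close>

lemma t_foldr_t:
  assumes "set ks \<subseteq> I" "j \<in> I" "x \<in> C" "a \<in> C" "a' \<in> C" "b \<in> I \<rightarrow> C" "b' \<in> I \<rightarrow> C"
    "c \<in> C" "c' \<in> C"
  shows "t j x (foldr (\<lambda>k u. t k a u (b k)) ks c) (foldr (\<lambda>k u. t k a' u (b' k)) ks c') =
         foldr (\<lambda>k u. t k (t j x a a') u (t j x (b k) (b' k))) ks (t j x c c')"
  using assms(1)
proof (induction ks)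
  case (Cons k ks)
  have "foldr (\<lambda>k u. t k a u (b k)) ks c \<in> C" "foldr (\<lambda>k u. t k a' u (b' k)) ks c' \<in> C"
    using Cons.prems assms by (auto intro!: foldr_t_closed)
  moreover have "k \<in> I" "b k \<in> C" "b' k \<in> C"
    using Cons.prems assms by auto
  ultimately show ?case
    using Cons assms by (simp add: t_hom del: atLeastAtMost_iff)
qed simp

lemma t_N:
  assumes "j \<in> I" "x \<in> C" "a \<in> C" "a' \<in> C" "b \<in> I \<rightarrow> C" "b' \<in> I \<rightarrow> C"
  shows "t j x (N a b) (N a' b') = N (t j x a a') (\<lambda>k. t j x (b k) (b' k))"
proof -
  have "b n \<in> C" "b' n \<in> C" using assms n_mem by auto
  then show ?thesis
    unfolding nested_def using assms by (intro t_foldr_t[OF set_upt_subset])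
qed

text \<open>Each outer layer is pushed through \<open>N\<close> by \<open>t_N\<close>. The list
  \<open>ks\<close> is generalized for the induction; the list \<open>[1..<n]\<close> gives
  (B3).\<close>

lemma foldr_t_N:
  assumes "set ks \<subseteq> I" "y \<in> C" "X0 \<in> I \<rightarrow> C" "X \<in> I \<rightarrow> I \<rightarrow> C"
  shows "foldr (\<lambda>k u. t k y u (N (X0 k) (X k))) ks (N (X0 n) (X n)) =
         N (foldr (\<lambda>k u. t k y u (X0 k)) ks (X0 n)) (\<lambda>l. foldr (\<lambda>k u. t k y u (X k l)) ks (X n l))"
  using assms(1)
proof (induction ks)
  case (Cons k ks)
  have k: "k \<in> I" "X0 k \<in> C" "X k \<in> I \<rightarrow> C" "X0 n \<in> C" "X n \<in> I \<rightarrow> C"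
    using Cons.prems assms n_mem by auto
  moreover have "foldr (\<lambda>k u. t k y u (X0 k)) ks (X0 n) \<in> C"
    using Cons.prems assms k by (auto intro!: foldr_t_closed)
  moreover have "(\<lambda>l. foldr (\<lambda>k u. t k y u (X k l)) ks (X n l)) \<in> I \<rightarrow> C"
    using Cons.prems assms k n_mem by (auto intro!: foldr_t_closed)
  ultimately show ?case
    using Cons assms(2) by (simp add: t_N del: atLeastAtMost_iff)
qed simp

lemma N_hom:
  assumes "y \<in> C" "X0 \<in> I \<rightarrow> C" "X \<in> I \<rightarrow> I \<rightarrow> C"
  shows "N y (\<lambda>k. N (X0 k) (X k)) = N (N y X0) (\<lambda>l. N y (\<lambda>k. X k l))"
  using foldr_t_N[OF set_upt_subset assms] unfolding nested_def .

text \<open>A layer \<open>j\<close> beneath a fold commutes outwards by (N3) until it meets the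
  innermost layer \<open>j\<close> of the fold, which swallows it by
  \<open>t_absorb_left\<close>.\<close>

lemma foldr_absorb:
  assumes "set ks \<subseteq> I" "j \<in> set ks" "x \<in> C" "y \<in> I \<rightarrow> C" "a \<in> C" "b \<in> C"
  shows "foldr (\<lambda>k u. t k x u (y k)) ks (t j x a b) = foldr (\<lambda>k u. t k x u (y k)) ks a"
proof -
  have pull: "foldr (\<lambda>k u. t k x u (y k)) ks (t j x a b) =
              t j x (foldr (\<lambda>k u. t k x u (y k)) ks a) b"
    if "set ks \<subseteq> I" "j \<notin> set ks" "j \<in> I" for ks
    using that
  proof (induction ks)
    case (Cons k ks)
    have "foldr (\<lambda>k u. t k x u (y k)) ks a \<in> C" "k \<in> I" "y k \<in> C"
      using Cons.prems assms by (auto intro!: foldr_t_closed)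
    then show ?case
      using Cons assms t_commute[of k j x _ b "y k"] by auto
  qed simp
  show ?thesis
    using assms(1,2)
  proof (induction ks)
    case (Cons k ks)
    show ?case
    proof (cases "j \<in> set ks")
      case True
      then show ?thesis using Cons by auto
    next
      \<comment> \<open>Here the head \<open>k\<close> is the last, hence innermost, occurrence of
        \<open>j\<close>, so \<open>pull\<close> applies to the whole tail.\<close>
      case False
      then have [simp]: "k = j" and j: "j \<in> I" "y j \<in> C"
        using Cons.prems assms by auto
      have "foldr (\<lambda>k u. t k x u (y k)) ks a \<in> C"
        using Cons.prems assms by (auto intro!: foldr_t_closed)
      then show ?thesis
        using pull[of ks] False Cons.prems assms j t_absorb_left[of j x _ b "y j"] by simp
    qed
  qed simp
qed

lemma foldr_foldr_absorb:
  assumes "set ks \<subseteq> I" "set js \<subseteq> set ks" "x \<in> C" "y \<in> I \<rightarrow> C" "w \<in> I \<rightarrow> C" "a \<in> C"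
  shows "foldr (\<lambda>k u. t k x u (y k)) ks (foldr (\<lambda>k u. t k x u (w k)) js a) =
         foldr (\<lambda>k u. t k x u (y k)) ks a"
  using assms(2)
proof (induction js)
  case (Cons j js)
  have "foldr (\<lambda>k u. t k x u (w k)) js a \<in> C" "w j \<in> C"
    using Cons.prems assms by (auto intro!: foldr_t_closed)
  then show ?case
    using Cons assms foldr_absorb[of ks j x y _ "w j"] by simp
qed simp

text \<open>From the outside in, layers other than \<open>i\<close> are discarded by
  \<open>t_absorb_other\<close>; the first layer \<open>i\<close> leaves its entry
  \<open>w i\<close> by \<open>t_absorb_right\<close>.\<close>

lemma t_foldr_right:
  assumes "set ks \<subseteq> I" "i \<in> set ks" "x \<in> C" "u \<in> C" "w \<in> I \<rightarrow> C" "a \<in> C"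
  shows "t i x u (foldr (\<lambda>k u. t k x u (w k)) ks a) = t i x u (w i)"
  using assms(1,2)
proof (induction ks)
  case (Cons k ks)
  have "foldr (\<lambda>k u. t k x u (w k)) ks a \<in> C" "k \<in> I" "w k \<in> C" "i \<in> I"
    using Cons.prems assms by (auto intro!: foldr_t_closed)
  then show ?case
    using Cons assms t_absorb_other[of i k x u _ "w k"] t_absorb_right[of i x u _ "w k"]
    by (cases "k = i") auto
qed simp

text \<open>This is (B2) for \<open>N\<close>. Indices below \<open>n\<close> occur as layers and
  index \<open>n\<close> as the seed, so two different absorptions produce the diagonal
  entries.\<close>

lemma N_diag:
  assumes y: "y \<in> C" and X: "X \<in> I \<rightarrow> I \<rightarrow> C"
  shows "N y (\<lambda>k. N y (X k)) = N y (\<lambda>k. X k k)"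
proof -
  have Xn: "X n \<in> I \<rightarrow> C" using X n_mem by (rule Pi_mem)
  then have Xnn: "X n n \<in> C" using n_mem by (rule Pi_mem)
  \<comment> \<open>In third position of layer \<open>k\<close>, the value \<open>N y (X k)\<close>
    counts only through its own layer \<open>k\<close>, whose entry is \<open>X k k\<close>.\<close>
  have layers: "foldr (\<lambda>k u. t k y u (N y (X k))) ks a = foldr (\<lambda>k u. t k y u (X k k)) ks a"
    if "set ks \<subseteq> set [1..<n]" "a \<in> C" for ks a
    using that(1)
  proof (induction ks)
    case (Cons k ks)
    have k: "k \<in> set [1..<n]" "X k \<in> I \<rightarrow> C"
      using Cons.prems X by auto
    have kn: "X k n \<in> C"
      using k(2) n_mem by (rule Pi_mem)
    have "foldr (\<lambda>k u. t k y u (X k k)) ks a \<in> C"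
      using Cons.prems X y that(2) by (intro foldr_t_closed) auto
    then show ?case
      using Cons t_foldr_right[OF set_upt_subset k(1) y _ k(2) kn] by (simp add: nested_def)
  qed simp
  have "N y (\<lambda>k. N y (X k)) = foldr (\<lambda>k u. t k y u (X k k)) [1..<n] (N y (X n))"
    unfolding nested_def[of n t y "\<lambda>k. N y (X k)"] using layers y Xn by simp
  \<comment> \<open>The seed \<open>N y (X n)\<close> lies beneath layers with all indices of its
    own layers; these are absorbed and only its seed \<open>X n n\<close> remains.\<close>
  also have "\<dots> = foldr (\<lambda>k u. t k y u (X k k)) [1..<n] (X n n)"
    unfolding nested_def
    using foldr_foldr_absorb[OF set_upt_subset subset_refl y _ Xn Xnn, of "\<lambda>k. X k k"] X by auto
  finally show ?thesis by (simp add: nested_def)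
qed

section \<open>The nBA of a skew star algebra, and the way back\<close>

lemma N_restrict: "N x (\<lambda>k\<in>I. y k) = N x y"
  using n_ge_2 by (intro nested_cong) auto

lemma qop_bullet: "x \<in> C \<Longrightarrow> y \<in> I \<rightarrow> C \<Longrightarrow> qop (bullet n B) x (\<lambda>k\<in>I. y k) = N x y"
  using N_restrict by (simp add: bullet_def restrict_Pi_cancel PiE_def)

lemma qop_bullet': "x \<in> C \<Longrightarrow> y \<in> I \<rightarrow>\<^sub>E C \<Longrightarrow> qop (bullet n B) x y = N x y"
  by (simp add: bullet_def)

text \<open>The identities are already available for \<open>N\<close>; what remains is to pass
  between extensional tuples and functions in \<open>I \<rightarrow> C\<close>, under each
  application of the operation.\<close>

lemma nBA_bullet: "nBA n (bullet n B)"
proof -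
  let ?q = "qop (bullet n B)"
  have carrier [simp]: "carrier (bullet n B) = C" and econst [simp]: "econst (bullet n B) = z"
    by (simp_all add: bullet_def)
  have "is_q_algebra n (bullet n B)"
    unfolding is_q_algebra_def bullet_def using z_mem N_closed
    by (simp add: restrict_PiE_iff PiE_def del: atLeastAtMost_iff)
  moreover have "\<forall>i\<in>I. \<forall>x\<in>I \<rightarrow>\<^sub>E C. ?q (z i) x = x i"
  proof (intro ballI)
    fix i x assume "i \<in> I" "x \<in> I \<rightarrow>\<^sub>E C"
    moreover from this have "x \<in> I \<rightarrow> C" by auto
    ultimately show "?q (z i) x = x i"
      using N_zero by (simp add: qop_bullet' del: atLeastAtMost_iff)
  qed
  moreover have "\<forall>y\<in>C. \<forall>x\<in>C. ?q y (\<lambda>k\<in>I. x) = x"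
    using foldr_same[OF set_upt_subset] by (simp add: qop_bullet nested_def del: One_nat_def)
  moreover have "\<forall>y\<in>C. \<forall>x\<in>I \<rightarrow> (I \<rightarrow>\<^sub>E C).
      ?q y (\<lambda>k\<in>I. ?q y (x k)) = ?q y (\<lambda>k\<in>I. x k k)"
  proof (intro ballI)
    fix y x assume y: "y \<in> C" and x: "x \<in> I \<rightarrow> (I \<rightarrow>\<^sub>E C)"
    have x': "x \<in> I \<rightarrow> I \<rightarrow> C" by (intro Pi_I PiE_mem[OF Pi_mem[OF x]])
    have "(\<lambda>k\<in>I. ?q y (x k)) = (\<lambda>k\<in>I. N y (x k))"
      by (intro restrict_ext qop_bullet' y Pi_mem[OF x])
    moreover have "(\<lambda>k. N y (x k)) \<in> I \<rightarrow> C"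
      by (intro Pi_I N_closed y Pi_mem[OF x'])
    moreover have "(\<lambda>k. x k k) \<in> I \<rightarrow> C"
      by (intro Pi_I Pi_mem[OF Pi_mem[OF x']])
    ultimately show "?q y (\<lambda>k\<in>I. ?q y (x k)) = ?q y (\<lambda>k\<in>I. x k k)"
      using N_diag[OF y x'] y by (simp add: qop_bullet del: One_nat_def)
  qed
  moreover have "\<forall>y\<in>C. \<forall>x\<in>I \<rightarrow> ({0..n} \<rightarrow> C).
      ?q y (\<lambda>k\<in>I. ?q (x k 0) (\<lambda>l\<in>I. x k l)) =
      ?q (?q y (\<lambda>k\<in>I. x k 0)) (\<lambda>l\<in>I. ?q y (\<lambda>k\<in>I. x k l))"
  proof (intro ballI)
    fix y x assume y: "y \<in> C" and x: "x \<in> I \<rightarrow> ({0..n} \<rightarrow> C)"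
    have x0: "(\<lambda>k. x k 0) \<in> I \<rightarrow> C" and x': "x \<in> I \<rightarrow> I \<rightarrow> C"
      by (intro Pi_I Pi_mem[OF Pi_mem[OF x]]; simp)+
    have "(\<lambda>k\<in>I. ?q (x k 0) (\<lambda>l\<in>I. x k l)) = (\<lambda>k\<in>I. N (x k 0) (x k))"
      by (intro restrict_ext qop_bullet Pi_mem[OF x0] Pi_mem[OF x'])
    moreover have "(\<lambda>l\<in>I. ?q y (\<lambda>k\<in>I. x k l)) = (\<lambda>l\<in>I. N y (\<lambda>k. x k l))"
      by (intro restrict_ext qop_bullet y Pi_I Pi_mem[OF Pi_mem[OF x']])
    moreover have "(\<lambda>k. N (x k 0) (x k)) \<in> I \<rightarrow> C"
      by (intro Pi_I N_closed Pi_mem[OF x0] Pi_mem[OF x'])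
    moreover have "(\<lambda>l. N y (\<lambda>k. x k l)) \<in> I \<rightarrow> C"
      by (intro Pi_I N_closed y Pi_mem[OF Pi_mem[OF x']])
    ultimately show "?q y (\<lambda>k\<in>I. ?q (x k 0) (\<lambda>l\<in>I. x k l)) =
        ?q (?q y (\<lambda>k\<in>I. x k 0)) (\<lambda>l\<in>I. ?q y (\<lambda>k\<in>I. x k l))"
      using N_hom[OF y x0 x'] x0 y by (simp add: qop_bullet del: One_nat_def)
  qed
  moreover have "\<forall>y\<in>C. ?q y z = y"
    using N_unit z_mem by (simp add: qop_bullet' del: One_nat_def)
  ultimately show ?thesis
    unfolding nBA_def Let_def carrier econst by (intro conjI)
qed

text \<open>The curried operations are compared one argument at a time: outside the domain both are
  \<open>undefined\<close>, and once all arguments are inside, the equation is (N4).\<close>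

lemma star_bullet: "star n (bullet n B) = B"
proof -
  have carrier: "carrier (bullet n B) = C" and econst: "econst (bullet n B) = z"
    by (simp_all add: bullet_def)
  let ?s = "\<lambda>i\<in>I. \<lambda>x\<in>C. \<lambda>a\<in>C. \<lambda>b\<in>C. qop (bullet n B) x (\<lambda>k\<in>I. if k = i then b else a)"
  have "?s i = t i" for i
  proof (cases "i \<in> I")
    case i: True
    note t1 = PiE_mem[OF t_mem i]
    have "?s i x = t i x" for x
    proof (cases "x \<in> C")
      case x: True
      note t2 = PiE_mem[OF t1 x]
      have "?s i x a = t i x a" for a
      proof (cases "a \<in> C")
        case a: True
        note t3 = PiE_mem[OF t2 a]
        have "?s i x a b = t i x a b" for b
        proof (cases "b \<in> C")
          case b: True
          have "qop (bullet n B) x (\<lambda>k\<in>I. if k = i then b else a) =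
                N x (\<lambda>k. if k = i then b else a)"
            by (rule qop_bullet) (use x a b in auto)
          also have "\<dots> = t i x a b"
            using t_eq_N[OF i x a b] by simp
          finally show ?thesis using i x a b by simp
        qed (use i x a PiE_arb[OF t3] in simp)
        then show ?thesis by blast
      qed (use i x PiE_arb[OF t2] in simp)
      then show ?thesis by blast
    qed (use i PiE_arb[OF t1] in simp)
    then show ?thesis by blast
  qed (use PiE_arb[OF t_mem] in auto)
  then have "?s = t" by blast
  then show ?thesis
    by (simp add: star_def carrier econst)
qed

end

theorem theorem5p2:
  fixes n :: nat
  assumes "n \<ge> 2"
  shows "(\<forall>A :: 'a q_algebra. nBA n A \<longrightarrow> skew_star_algebra n (star n A)) \<and>
         (\<forall>B :: 'a t_algebra. skew_star_algebra n B \<longrightarrow> nBA n (bullet n B)) \<and>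
         (\<forall>A :: 'a q_algebra. nBA n A \<longrightarrow> bullet n (star n A) = A) \<and>
         (\<forall>B :: 'a t_algebra. skew_star_algebra n B \<longrightarrow> star n (bullet n B) = B)"
proof -
  have "boolean_like_algebra n A" if "nBA n A" for A :: "'a q_algebra"
    using that assms by unfold_locales
  moreover have "skew_star n B" if "skew_star_algebra n B" for B :: "'a t_algebra"
    using that assms by unfold_locales
  ultimately show ?thesis
    using boolean_like_algebra.skew_star_algebra_star boolean_like_algebra.bullet_star
      skew_star.nBA_bullet skew_star.star_bullet by blast
qed

end
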